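(* Let $h>0$ and $0<k<1$. Let $X=(X_1,X_2)\sim\mathcal{N}(0,\mathsf{I}_2)$, $W=(W_1,W_2)\sim\mathcal{N}(0,\mathsf{I}_2)$ and $\Omega\sim\mathcal{N}(0,1)$ be mutually independent. Put $R=\|X\|$, let $\varphi$ be the phase (polar) angle of $X$, so that $X=(R\cos\varphi,R\sin\varphi)$, and define $$R'=\Big((1-k^2)R^2+2k\sqrt{1-k^2}\,R\,W_1+k^2\|W\|^2\Big)^{1/2},\qquad \varphi'=\varphi+h\,\Omega,$$ $$X'=(R'\cos\varphi',\,R'\sin\varphi').$$ Then $R'\sim\mathrm{Rayleigh}(1)$, $\varphi'$ is uniformly distributed modulo $2\pi$, and $X'\sim\mathcal{N}(0,\mathsf{I}_2)$, that is, $X'$ follows the same Gaussian distribution as $X$.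
   Context: $\|\cdot\|$ is the Euclidean norm on $\mathbb{R}^2$, $\mathsf{I}_2$ is the $2\times2$ identity matrix, and $\mathrm{Rayleigh}(1)$ is the distribution on $[0,\infty)$ with density $\rho\mapsto\rho e^{-\rho^2/2}$. The phase angle is the two-argument arctangent of the coordinates of $X$; angles are considered modulo $2\pi$. *)

theory Defs
  imports "HOL-Probability.Probability" "HOL-Library.Real_Mod"
begin

text \<open>Density of the standard Gaussian \<open>N(0, I\<^sub>2)\<close> on \<open>\<real>\<^sup>2\<close> with respect to Lebesgue measure.\<close>

definition std_normal_density2 :: "real^2 \<Rightarrow> real" where
  "std_normal_density2 x = exp (- (norm x)\<^sup>2 / 2) / (2 * pi)"

definition rayleigh_density :: "real \<Rightarrow> real" where
  "rayleigh_density \<rho> = (if 0 \<le> \<rho> then \<rho> * exp (- \<rho>\<^sup>2 / 2) else 0)"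

text \<open>Two-argument arctangent, with values in \<open>(-pi, pi]\<close>; the angle of the origin is \<open>0\<close>.\<close>

definition phase :: "real^2 \<Rightarrow> real" where
  "phase x = Arg (Complex (x $ 1) (x $ 2))"

lemma phase_polar: "x = vector [norm x * cos (phase x), norm x * sin (phase x)]"
proof -
  define z where "z = Complex (x $ 1) (x $ 2)"
  have "norm x = cmod z"
    by (simp add: z_def norm_vec_def L2_set_def sum_2 cmod_def)
  moreover have "rcis (cmod z) (Arg z) = z"
    by (rule rcis_cmod_Arg)
  ultimately have "Re z = norm x * cos (phase x)" "Im z = norm x * sin (phase x)"
    by (metis Re_rcis phase_def z_def, metis Im_rcis phase_def \<open>norm x = cmod z\<close> z_def \<open>rcis (cmod z) (Arg z) = z\<close>)
  then show ?thesis
    by (simp add: z_def vec_eq_iff forall_2)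
qed

text \<open>
  The library's \<open>indep_vars\<close> requires all variables of a family to have the same codomain type;
  the following is its definition for three variables with possibly different codomain types.
\<close>

definition (in prob_space) indep_vars3 ::
    "'b measure \<Rightarrow> ('a \<Rightarrow> 'b) \<Rightarrow> 'c measure \<Rightarrow> ('a \<Rightarrow> 'c) \<Rightarrow> 'd measure \<Rightarrow> ('a \<Rightarrow> 'd) \<Rightarrow> bool" where
  "indep_vars3 N1 Y1 N2 Y2 N3 Y3 \<longleftrightarrow>
     random_variable N1 Y1 \<and> random_variable N2 Y2 \<and> random_variable N3 Y3 \<and>
     indep_sets
       ((!) [{Y1 -` A \<inter> space M | A. A \<in> sets N1},
             {Y2 -` A \<inter> space M | A. A \<in> sets N2},
             {Y3 -` A \<inter> space M | A. A \<in> sets N3}])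
       {0, 1, 2}"

end

theory Submission
  imports Defs
begin

text \<open>
  Write \<open>\<gamma>\<close> for the planar standard Gaussian law and \<open>c = sqrt (1 - k\<^sup>2)\<close>.  Two facts about \<open>\<gamma>\<close> explain the
  theorem.

  The radius.  Turning the plane by the angle \<open>\<phi>\<close> of \<open>X\<close> takes the point \<open>(R, 0)\<close> to \<open>X\<close>, so
  the formula for \<open>R'\<close> says \<open>R' = \<parallel>c (R, 0) + k W\<parallel> = \<parallel>c X + k rot\<^sub>\<phi> W\<parallel>\<close> (\<open>radial_step_eq_norm\<close>).  Given
  \<open>X\<close>, the vector \<open>rot\<^sub>\<phi> W\<close> has law \<open>\<gamma>\<close>, because \<open>\<gamma>\<close> is rotation invariant; and \<open>c X + k W\<close> has law
  \<open>\<gamma>\<close> when \<open>c\<^sup>2 + k\<^sup>2 = 1\<close> (\<open>nn_integral_gauss2_convolution\<close>).  Hence \<open>R'\<close> is distributed like the norm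
  of a vector of law \<open>\<gamma>\<close> (\<open>nn_integral_radial_step\<close>).

  The angle.  Under \<open>\<gamma>\<close> the angle modulo \<open>2\<pi>\<close> is uniform and independent of the norm
  (\<open>nn_integral_gauss2_polar\<close>); this too is rotation invariance, averaged over all rotations.  As the
  uniform law on the circle is invariant under shifts, adding \<open>h \<Omega>\<close> to the angle leaves it
  uniform, also conditionally on \<open>R\<close>, \<open>W\<close> and \<open>\<Omega>\<close>.

  Together, \<open>(R', \<phi>' mod 2\<pi>)\<close> has the same joint law as \<open>(R, \<phi> mod 2\<pi>)\<close>
  (\<open>nn_integral_gauss2_step\<close>).  The law of \<open>X'\<close> is its image under the polar map, and this gives
  back the law \<open>\<gamma>\<close> of \<open>X\<close>.  That \<open>R\<close> is Rayleigh
  distributed comes from the area \<open>\<pi> r\<^sup>2\<close> of a disc (\<open>distr_lborel_norm\<close>).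
\<close>

section \<open>Joint law of three independent variables\<close>

lemma (in prob_space) indep_vars3_prob:
  assumes "indep_vars3 N1 Y1 N2 Y2 N3 Y3" "A \<in> sets N1" "B \<in> sets N2" "C \<in> sets N3"
  shows "prob (Y1 -` A \<inter> space M \<inter> (Y2 -` B \<inter> space M) \<inter> (Y3 -` C \<inter> space M)) =
    prob (Y1 -` A \<inter> space M) * prob (Y2 -` B \<inter> space M) * prob (Y3 -` C \<inter> space M)"
proof -
  have ind: "indep_sets ((!) [{Y1 -` A \<inter> space M | A. A \<in> sets N1},
             {Y2 -` A \<inter> space M | A. A \<in> sets N2},
             {Y3 -` A \<inter> space M | A. A \<in> sets N3}]) {0, 1, 2}" (is "indep_sets ?F _")
    using assms(1) by (simp add: indep_vars3_def)
  define D where "D = (!) [Y1 -` A \<inter> space M, Y2 -` B \<inter> space M, Y3 -` C \<inter> space M]"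
  have "\<forall>j\<in>{0, 1, 2}. D j \<in> ?F j"
    using assms by (auto simp: D_def)
  from indep_setsD[OF ind _ _ _ this] show ?thesis
    by (simp add: D_def Int_assoc mult.assoc)
qed

lemma (in prob_space) distr_pair_eqI:
  assumes [measurable]: "random_variable N1 Y1" "random_variable N2 Y2"
    and "\<And>A B. A \<in> sets N1 \<Longrightarrow> B \<in> sets N2 \<Longrightarrow>
      prob (Y1 -` A \<inter> space M \<inter> (Y2 -` B \<inter> space M)) =
      prob (Y1 -` A \<inter> space M) * prob (Y2 -` B \<inter> space M)"
  shows "distr M (N1 \<Otimes>\<^sub>M N2) (\<lambda>\<omega>. (Y1 \<omega>, Y2 \<omega>)) = distr M N1 Y1 \<Otimes>\<^sub>M distr M N2 Y2"
proof (rule sym, rule pair_measure_eqI)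
  interpret D1: prob_space "distr M N1 Y1" by (rule prob_space_distr) fact
  interpret D2: prob_space "distr M N2 Y2" by (rule prob_space_distr) fact
  show "sigma_finite_measure (distr M N1 Y1)" "sigma_finite_measure (distr M N2 Y2)" ..
  fix A B assume AB: "A \<in> sets (distr M N1 Y1)" "B \<in> sets (distr M N2 Y2)"
  have "(\<lambda>\<omega>. (Y1 \<omega>, Y2 \<omega>)) -` (A \<times> B) \<inter> space M =
      Y1 -` A \<inter> space M \<inter> (Y2 -` B \<inter> space M)" by auto
  with AB show "emeasure (distr M N1 Y1) A * emeasure (distr M N2 Y2) B =
      emeasure (distr M (N1 \<Otimes>\<^sub>M N2) (\<lambda>\<omega>. (Y1 \<omega>, Y2 \<omega>))) (A \<times> B)"
    by (simp add: emeasure_distr emeasure_eq_measure assms(3) ennreal_mult)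
qed simp

text \<open>
  The product rule on boxes determines the joint law by two applications of uniqueness of product
  measures.  For the second, the rule is needed for all measurable sets \<open>E\<close> of pairs, and
  not only for boxes: the event \<open>Y1 \<in> A\<close> is fixed and \<open>M\<close> is restricted to it; under the
  restricted measure \<open>(Y2, Y3)\<close> has again a product law, scaled by the probability of the event.
\<close>

lemma (in prob_space) distr_indep_vars3:
  assumes ind: "indep_vars3 N1 Y1 N2 Y2 N3 Y3"
  shows "distr M (N1 \<Otimes>\<^sub>M (N2 \<Otimes>\<^sub>M N3)) (\<lambda>\<omega>. (Y1 \<omega>, Y2 \<omega>, Y3 \<omega>)) =
    distr M N1 Y1 \<Otimes>\<^sub>M (distr M N2 Y2 \<Otimes>\<^sub>M distr M N3 Y3)"
proof -
  have [measurable]: "random_variable N1 Y1" "random_variable N2 Y2" "random_variable N3 Y3"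
    using ind by (auto simp: indep_vars3_def)
  note P = indep_vars3_prob[OF ind]
  have yy: "Y -` space N \<inter> space M = space M" if "random_variable N Y" for N and Y :: "'a \<Rightarrow> 'z"
    using measurable_space[OF that] by auto
  have pair23: "distr M (N2 \<Otimes>\<^sub>M N3) (\<lambda>\<omega>. (Y2 \<omega>, Y3 \<omega>)) = distr M N2 Y2 \<Otimes>\<^sub>M distr M N3 Y3"
  proof (rule distr_pair_eqI)
    fix B C assume "B \<in> sets N2" "C \<in> sets N3"
    from P[OF sets.top this] show "prob (Y2 -` B \<inter> space M \<inter> (Y3 -` C \<inter> space M)) =
        prob (Y2 -` B \<inter> space M) * prob (Y3 -` C \<inter> space M)"
      by (simp add: yy prob_space Int_absorb1)
  qed measurable
  interpret D3: prob_space "distr M N3 Y3" by (rule prob_space_distr) measurable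
  have "distr M (N1 \<Otimes>\<^sub>M (N2 \<Otimes>\<^sub>M N3)) (\<lambda>\<omega>. (Y1 \<omega>, (\<lambda>\<omega>. (Y2 \<omega>, Y3 \<omega>)) \<omega>)) =
      distr M N1 Y1 \<Otimes>\<^sub>M distr M (N2 \<Otimes>\<^sub>M N3) (\<lambda>\<omega>. (Y2 \<omega>, Y3 \<omega>))"
  proof (rule distr_pair_eqI)
    fix A E assume A: "A \<in> sets N1" and E: "E \<in> sets (N2 \<Otimes>\<^sub>M N3)"
    define MA where "MA = density M (indicator (Y1 -` A \<inter> space M))"
    have Am[measurable]: "Y1 -` A \<inter> space M \<in> events" using A by measurable
    have MA: "emeasure MA S = emeasure M (Y1 -` A \<inter> space M \<inter> S)" if "S \<in> events" for S
      unfolding MA_def using that by (simp add: emeasure_restricted)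
    have sMA: "sets MA = events" "space MA = space M" by (auto simp: MA_def)
    note [measurable_cong] = sMA(1)
    define a where "a = emeasure M (Y1 -` A \<inter> space M)"
    have law2: "distr MA N2 Y2 = scale_measure a (distr M N2 Y2)"
    proof (rule measure_eqI)
      fix B assume "B \<in> sets (distr MA N2 Y2)"
      then have B: "B \<in> sets N2" by simp
      from P[OF A this sets.top] B show "emeasure (distr MA N2 Y2) B = emeasure (scale_measure a (distr M N2 Y2)) B"
        by (simp add: emeasure_distr sMA MA yy prob_space emeasure_eq_measure ennreal_mult a_def Int_absorb2)
    qed simp
    interpret FA: finite_measure "distr MA N2 Y2"
      by (rule finite_measureI) (simp add: emeasure_distr sMA MA yy a_def)
    have "distr MA N2 Y2 \<Otimes>\<^sub>M distr M N3 Y3 = distr MA (N2 \<Otimes>\<^sub>M N3) (\<lambda>\<omega>. (Y2 \<omega>, Y3 \<omega>))"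
    proof (rule pair_measure_eqI)
      show "sigma_finite_measure (distr MA N2 Y2)" "sigma_finite_measure (distr M N3 Y3)" ..
      fix B C assume "B \<in> sets (distr MA N2 Y2)" "C \<in> sets (distr M N3 Y3)"
      then have BC: "B \<in> sets N2" "C \<in> sets N3" by auto
      have "(\<lambda>\<omega>. (Y2 \<omega>, Y3 \<omega>)) -` (B \<times> C) \<inter> space M =
        Y2 -` B \<inter> space M \<inter> (Y3 -` C \<inter> space M)" by auto
      moreover have "Y2 -` B \<inter> space M \<inter> (Y3 -` C \<inter> space M) \<in> events"
        using BC by (intro sets.Int measurable_sets) auto
      ultimately show "emeasure (distr MA N2 Y2) B * emeasure (distr M N3 Y3) C =
          emeasure (distr MA (N2 \<Otimes>\<^sub>M N3) (\<lambda>\<omega>. (Y2 \<omega>, Y3 \<omega>))) (B \<times> C)"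
        using P[OF A BC] BC unfolding law2
        by (simp add: emeasure_distr sMA MA emeasure_eq_measure ennreal_mult a_def Int_assoc mult.assoc)
    qed simp
    then have "emeasure M (Y1 -` A \<inter> space M \<inter> ((\<lambda>\<omega>. (Y2 \<omega>, Y3 \<omega>)) -` E \<inter> space M)) =
        emeasure (scale_measure a (distr M N2 Y2) \<Otimes>\<^sub>M distr M N3 Y3) E"
      using E unfolding law2 by (simp add: emeasure_distr sMA MA)
    also have "\<dots> = a * emeasure (distr M N2 Y2 \<Otimes>\<^sub>M distr M N3 Y3) E"
    proof -
      have "E \<in> sets (distr M N2 Y2 \<Otimes>\<^sub>M distr M N3 Y3)"
        "E \<in> sets (scale_measure a (distr M N2 Y2) \<Otimes>\<^sub>M distr M N3 Y3)"
        using E by (simp_all cong: sets_pair_measure_cong)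
      moreover have "(\<lambda>x. emeasure (distr M N3 Y3) (Pair x -` E)) \<in> borel_measurable (distr M N2 Y2)"
        using calculation(1) by (rule D3.measurable_emeasure_Pair)
      ultimately show ?thesis
        by (simp only: D3.emeasure_pair_measure_alt nn_integral_scale_measure)
    qed
    also have "\<dots> = a * emeasure M ((\<lambda>\<omega>. (Y2 \<omega>, Y3 \<omega>)) -` E \<inter> space M)"
      using E by (simp flip: pair23 add: emeasure_distr)
    finally show "prob (Y1 -` A \<inter> space M \<inter> ((\<lambda>\<omega>. (Y2 \<omega>, Y3 \<omega>)) -` E \<inter> space M)) =
        prob (Y1 -` A \<inter> space M) * prob ((\<lambda>\<omega>. (Y2 \<omega>, Y3 \<omega>)) -` E \<inter> space M)"
      by (simp add: a_def emeasure_eq_measure flip: ennreal_mult)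
  qed measurable
  then show ?thesis by (simp add: pair23)
qed

section \<open>The planar Gaussian law\<close>

definition gauss2 :: "(real^2) measure" where
  "gauss2 = density lborel (\<lambda>x. ennreal (std_normal_density2 x))"

lemma measurable_std_normal_density2 [measurable]: "std_normal_density2 \<in> borel_measurable borel"
  unfolding std_normal_density2_def by measurable

lemma sets_gauss2 [simp, measurable_cong]: "sets gauss2 = sets borel"
  and space_gauss2 [simp]: "space gauss2 = UNIV"
  by (simp_all add: gauss2_def)

lemma measurable_rayleigh_density [measurable]: "rayleigh_density \<in> borel_measurable borel"
  unfolding rayleigh_density_def by measurable

text \<open>
  Integration in polar coordinates for radial functions, without a change of variables: both
  measures give \<open>{..r}\<close> the area of the disc of radius \<open>r\<close>.
\<close>

lemma distr_lborel_norm: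
  "distr lborel borel (norm :: real^2 \<Rightarrow> real) = density lborel (\<lambda>\<rho>. ennreal (2 * pi * \<rho>) * indicator {0..} \<rho>)"
  (is "?L = ?D")
proof (rule measure_eqI_generator_eq[where E = "range (\<lambda>r::real. {..r})" and \<Omega> = UNIV and A = "\<lambda>n. {..real n}"])
  show "Int_stable (range (\<lambda>r::real. {..r}))" by (auto simp: Int_stable_def)
  show "sets ?L = sigma_sets UNIV (range (\<lambda>r::real. {..r}))"
       "sets ?D = sigma_sets UNIV (range (\<lambda>r::real. {..r}))"
    by (simp_all add: borel_eq_atMost)
  have L: "emeasure ?L {..r} = (if 0 \<le> r then ennreal (pi * r\<^sup>2) else 0)" for r
  proof -
    have "emeasure ?L {..r} = emeasure lborel (cball (0 :: real^2) r)"
      by (auto simp: emeasure_distr cball_def dist_norm intro!: arg_cong[where f = "emeasure lborel"])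
    then show ?thesis by (auto simp: emeasure_cball unit_ball_vol_2)
  qed
  show "emeasure ?L {..real i} \<noteq> \<infinity>" for i by (simp add: L)
  fix S :: "real set" assume "S \<in> range (\<lambda>r. {..r})"
  then obtain r where S: "S = {..r}" by auto
  have "emeasure ?D S = (\<integral>\<^sup>+\<rho>. ennreal (2 * pi * \<rho>) * indicator {0..r} \<rho> \<partial>lborel)"
    by (auto simp: S emeasure_density indicator_def intro!: nn_integral_cong)
  also have "\<dots> = (if 0 \<le> r then ennreal (pi * r\<^sup>2) else 0)"
  proof (cases "0 \<le> r")
    case True
    then show ?thesis
      by (subst nn_integral_FTC_Icc[where F = "\<lambda>\<rho>. pi * \<rho>\<^sup>2"]) (auto intro!: derivative_eq_intros)
  qed simp
  finally show "emeasure ?L S = emeasure ?D S" by (simp add: S L)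
qed (auto simp: real_arch_simple)

lemma distr_gauss2_norm: "distr gauss2 borel norm = density lborel (\<lambda>\<rho>. ennreal (rayleigh_density \<rho>))"
proof -
  define f where "f \<rho> = ennreal (exp (- \<rho>\<^sup>2 / 2) / (2 * pi))" for \<rho> :: real
  have [measurable]: "f \<in> borel_measurable borel" unfolding f_def by measurable
  have "distr gauss2 borel norm = distr (density lborel (\<lambda>x :: real^2. f (norm x))) borel norm"
    by (simp add: gauss2_def f_def std_normal_density2_def)
  also have "\<dots> = density (distr lborel borel (norm :: real^2 \<Rightarrow> real)) f"
    by (rule density_distr[symmetric]) simp_all
  also have "\<dots> = density lborel (\<lambda>\<rho>. ennreal (2 * pi * \<rho>) * indicator {0..} \<rho> * f \<rho>)"
    by (simp add: distr_lborel_norm density_density_eq)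
  also have "\<dots> = density lborel (\<lambda>\<rho>. ennreal (rayleigh_density \<rho>))"
    by (intro density_cong) (auto simp: f_def rayleigh_density_def indicator_def simp flip: ennreal_mult)
  finally show ?thesis .
qed

text \<open>The total mass is computed on the law of the norm, whose density has an explicit primitive.\<close>

lemma prob_space_gauss2: "prob_space gauss2"
proof -
  have "(\<integral>\<^sup>+\<rho>. ennreal (rayleigh_density \<rho>) \<partial>lborel) =
      (\<integral>\<^sup>+\<rho>. ennreal (\<rho> * exp (- \<rho>\<^sup>2 / 2)) * indicator {0..} \<rho> \<partial>lborel)"
    by (auto simp: rayleigh_density_def indicator_def intro!: nn_integral_cong)
  also have "\<dots> = ennreal (0 - - exp (- 0\<^sup>2 / 2))"
  proof (rule nn_integral_FTC_atLeast)
    show "((\<lambda>\<rho>::real. - exp (- \<rho>\<^sup>2 / 2)) \<longlongrightarrow> 0) at_top"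
      by real_asymp
  qed (auto intro!: derivative_eq_intros simp: field_simps)
  finally have "emeasure (distr gauss2 borel norm) UNIV = 1"
    by (simp add: distr_gauss2_norm emeasure_density)
  then show ?thesis
    by (intro prob_spaceI) (simp add: emeasure_distr)
qed

interpretation gauss2: prob_space gauss2 by (rule prob_space_gauss2)

definition rot :: "real \<Rightarrow> real^2 \<Rightarrow> real^2" where
  "rot \<theta> x = vector [cos \<theta> * x $ 1 - sin \<theta> * x $ 2, sin \<theta> * x $ 1 + cos \<theta> * x $ 2]"

lemma rot_nth [simp]:
  "rot \<theta> x $ 1 = cos \<theta> * x $ 1 - sin \<theta> * x $ 2" "rot \<theta> x $ 2 = sin \<theta> * x $ 1 + cos \<theta> * x $ 2"
  by (simp_all add: rot_def)

lemma norm_vec2: "norm (x :: real^2) = sqrt ((x $ 1)\<^sup>2 + (x $ 2)\<^sup>2)"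
  by (simp add: norm_vec_def L2_set_def sum_2)

lemma norm_rot [simp]: "norm (rot \<theta> x) = norm x"
proof -
  have "(cos \<theta> * x $ 1 - sin \<theta> * x $ 2)\<^sup>2 + (sin \<theta> * x $ 1 + cos \<theta> * x $ 2)\<^sup>2 =
      ((cos \<theta>)\<^sup>2 + (sin \<theta>)\<^sup>2) * ((x $ 1)\<^sup>2 + (x $ 2)\<^sup>2)"
    by algebra
  then show ?thesis by (simp add: norm_vec2)
qed

lemma rot_rot: "rot \<theta> (rot \<eta> x) = rot (\<theta> + \<eta>) x"
  by (simp add: vec_eq_iff forall_2 cos_add sin_add algebra_simps)

lemma rot_0 [simp]: "rot 0 x = x"
  by (simp add: vec_eq_iff forall_2)

lemma measurable_vec2 [measurable (raw)]:
  assumes [measurable]: "f \<in> borel_measurable N" "g \<in> borel_measurable N"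
  shows "(\<lambda>\<omega>. vector [f \<omega>, g \<omega>] :: real^2) \<in> borel_measurable N"
proof (subst borel_measurable_euclidean_space, safe)
  fix i :: "real^2" assume "i \<in> Basis"
  then consider "i = axis 1 1" | "i = axis 2 1" by (auto simp: Basis_vec_def UNIV_2)
  then show "(\<lambda>\<omega>. (vector [f \<omega>, g \<omega>] :: real^2) \<bullet> i) \<in> borel_measurable N"
    by cases (auto simp: inner_axis)
qed

lemma measurable_vec_nth [measurable (raw)]:
  assumes "f \<in> borel_measurable N"
  shows "(\<lambda>\<omega>. (f \<omega> :: real^2) $ i) \<in> borel_measurable N"
  by (rule measurable_compose[OF assms])
     (intro borel_measurable_continuous_onI continuous_on_component continuous_on_id)

lemma measurable_rot [measurable (raw)]:
  assumes [measurable]: "f \<in> borel_measurable N" "g \<in> borel_measurable N"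
  shows "(\<lambda>\<omega>. rot (f \<omega>) (g \<omega>)) \<in> borel_measurable N"
  unfolding rot_def by measurable

lemma orthogonal_transformation_rot: "orthogonal_transformation (rot \<theta>)"
  unfolding orthogonal_transformation
  by (auto intro!: linearI simp: vec_eq_iff forall_2 algebra_simps)

lemma distr_lborel_rot: "distr lborel borel (rot \<theta>) = lborel"
proof (rule lborel_eqI[symmetric])
  fix l u :: "real^2" assume lu: "\<And>b. b \<in> Basis \<Longrightarrow> l \<bullet> b \<le> u \<bullet> b"
  have eq: "rot \<theta> -` box l u = rot (- \<theta>) ` box l u"
    by (auto simp: image_iff rot_rot intro!: bexI[where x = "rot \<theta> _"])
  have m: "rot (-\<theta>) ` box l u \<in> lmeasurable"
    "measure lebesgue (rot (-\<theta>) ` box l u) = measure lebesgue (box l u)"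
    by (intro measurable_orthogonal_image measure_orthogonal_image orthogonal_transformation_rot lmeasurable_box)+
  have "emeasure (distr lborel borel (rot \<theta>)) (box l u) = emeasure lborel (rot \<theta> -` box l u)"
    by (subst emeasure_distr) auto
  also have "\<dots> = emeasure lebesgue (rot \<theta> -` box l u)"
    using measurable_sets[of "rot \<theta>" borel borel "box l u"] by (simp add: emeasure_completion)
  also have "\<dots> = emeasure lebesgue (box l u)"
    unfolding eq using m by (metis emeasure_eq_measure2 lmeasurable_box)
  finally show "emeasure (distr lborel borel (rot \<theta>)) (box l u) = ennreal (\<Prod>b\<in>Basis. (u - l) \<bullet> b)"
    using lu by (simp add: emeasure_lborel_box)
qed simp

lemma distr_gauss2_rot: "distr gauss2 borel (rot \<theta>) = gauss2"
proof -
  have "gauss2 = density (distr lborel borel (rot \<theta>)) (\<lambda>x. ennreal (std_normal_density2 x))"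
    by (simp add: distr_lborel_rot gauss2_def)
  also have "\<dots> = distr (density lborel (\<lambda>x. ennreal (std_normal_density2 (rot \<theta> x)))) borel (rot \<theta>)"
    by (rule density_distr) simp_all
  finally show ?thesis by (simp add: gauss2_def std_normal_density2_def)
qed

lemma nn_integral_gauss2_rot:
  assumes [measurable]: "f \<in> borel_measurable borel"
  shows "(\<integral>\<^sup>+x. f (rot \<theta> x) \<partial>gauss2) = (\<integral>\<^sup>+x. f x \<partial>gauss2)"
proof -
  have "(\<integral>\<^sup>+x. f x \<partial>gauss2) = (\<integral>\<^sup>+x. f x \<partial>distr gauss2 borel (rot \<theta>))"
    by (simp only: distr_gauss2_rot)
  then show ?thesis by (simp add: nn_integral_distr)
qed

section \<open>Polar decomposition of the planar Gaussian law\<close>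

lemma phase_nth: "x $ 1 = norm x * cos (phase x)" "x $ 2 = norm x * sin (phase x)"
proof -
  have "x $ i = (vector [norm x * cos (phase x), norm x * sin (phase x)] :: real^2) $ i" for i
    using phase_polar[of x] by simp
  from this[of 1] this[of 2]
  show "x $ 1 = norm x * cos (phase x)" "x $ 2 = norm x * sin (phase x)" by simp_all
qed

text \<open>The origin is excluded, as all rotations leave its phase at \<open>0\<close>.\<close>

lemma phase_rot:
  assumes "x \<noteq> 0"
  shows "phase (rot \<theta> x) rmod (2 * pi) = (phase x + \<theta>) rmod (2 * pi)"
proof -
  have "norm x * cos (phase (rot \<theta> x)) = norm x * cos (phase x + \<theta>)"
    using phase_nth(1)[of "rot \<theta> x"] phase_nth[of x] by (simp add: cos_add algebra_simps)
  moreover have "norm x * sin (phase (rot \<theta> x)) = norm x * sin (phase x + \<theta>)"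
    using phase_nth(2)[of "rot \<theta> x"] phase_nth[of x] by (simp add: sin_add algebra_simps)
  ultimately have "cis (phase (rot \<theta> x)) = cis (phase x + \<theta>)"
    using assms by (simp add: complex_eq_iff)
  then show ?thesis by (simp add: cis_eq_iff rcong_def)
qed

text \<open>\<open>Arg\<close> is continuous off the closed negative half-axis and takes two values on it.\<close>

lemma measurable_Arg [measurable]: "Arg \<in> borel_measurable borel"
proof -
  have "(\<lambda>z. if z \<in> \<real>\<^sub>\<le>\<^sub>0 then (if z = 0 then 0 else pi) else Arg z) \<in> borel_measurable borel"
  proof (rule measurable_If_restrict_space_iff[THEN iffD2], safe)
    show "{z :: complex \<in> space borel. z \<in> \<real>\<^sub>\<le>\<^sub>0} \<in> sets borel"
      using borel_closed[OF closed_nonpos_Reals_complex] by simp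
    show "(\<lambda>z. if z = 0 then 0 else pi)
        \<in> borel_measurable (restrict_space borel {z::complex. z \<in> \<real>\<^sub>\<le>\<^sub>0})"
      by (rule measurable_restrict_space1) measurable
    have "{z::complex. z \<notin> \<real>\<^sub>\<le>\<^sub>0} = - \<real>\<^sub>\<le>\<^sub>0" by auto
    then show "Arg \<in> borel_measurable (restrict_space borel {z. z \<notin> \<real>\<^sub>\<le>\<^sub>0})"
      by (simp add: borel_measurable_continuous_on_restrict continuous_on_Arg)
  qed
  also have "(\<lambda>z. if z \<in> \<real>\<^sub>\<le>\<^sub>0 then (if z = 0 then 0 else pi) else Arg z) = Arg"
  proof (rule ext)
    fix z
    show "(if z \<in> \<real>\<^sub>\<le>\<^sub>0 then (if z = 0 then 0 else pi) else Arg z) = Arg z"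
    proof (cases "z = 0")
      case False
      then show ?thesis
        using Arg_eq_pi[of z] by (auto simp: complex_nonpos_Reals_iff complex_eq_iff)
    qed (simp add: Arg_zero)
  qed
  finally show ?thesis .
qed

lemma measurable_phase [measurable]: "phase \<in> borel_measurable borel"
proof -
  have "(\<lambda>x :: real^2. Complex (x $ 1) (x $ 2)) \<in> borel_measurable borel"
    by (simp add: Complex_eq)
  from measurable_compose[OF this measurable_Arg] show ?thesis
    by (simp add: phase_def[abs_def])
qed

lemma measurable_rmod [measurable (raw)]:
  assumes [measurable]: "f \<in> borel_measurable N"
  shows "(\<lambda>\<omega>. f \<omega> rmod c) \<in> borel_measurable N"
  unfolding rmod_def by measurable

definition circle_unif :: "real measure" where
  "circle_unif = uniform_measure lborel {0..<2 * pi}"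

lemma sets_circle_unif [simp, measurable_cong]: "sets circle_unif = sets borel"
  and space_circle_unif [simp]: "space circle_unif = UNIV"
  by (simp_all add: circle_unif_def)

interpretation circle_unif: prob_space circle_unif
  unfolding circle_unif_def by (rule prob_space_uniform_measure) simp_all

lemma nn_integral_circle_unif:
  assumes [measurable]: "f \<in> borel_measurable borel"
  shows "(\<integral>\<^sup>+\<theta>. f \<theta> \<partial>circle_unif) = (\<integral>\<^sup>+\<theta>. f \<theta> * indicator {0..<2 * pi} \<theta> \<partial>lborel) / ennreal (2 * pi)"
  unfolding circle_unif_def by (subst nn_integral_uniform_measure) simp_all

text \<open>
  A shift by \<open>b \<in> [0, 2\<pi>)\<close> moves \<open>[0, 2\<pi> - b)\<close> to \<open>[b, 2\<pi>)\<close> and wraps \<open>[2\<pi> - b, 2\<pi>)\<close> around to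
  \<open>[0, b)\<close>; each piece is merely translated.
\<close>

lemma nn_integral_circle_unif_shift:
  assumes [measurable]: "f \<in> borel_measurable borel"
  shows "(\<integral>\<^sup>+\<theta>. f ((\<theta> + a) rmod (2 * pi)) \<partial>circle_unif) = (\<integral>\<^sup>+\<theta>. f \<theta> \<partial>circle_unif)"
proof -
  define b where "b = a rmod (2 * pi)"
  have b: "0 \<le> b" "b < 2 * pi" by (simp_all add: b_def rmod_nonneg rmod_less)
  have ab: "(\<theta> + a) rmod (2 * pi) = (\<theta> + b) rmod (2 * pi)" for \<theta>
    using rmod_add[of \<theta> "2 * pi" a] rmod_add[of \<theta> "2 * pi" b] by (simp add: b_def)
  have lo: "(\<theta> + b) rmod (2 * pi) = \<theta> + b" if "0 \<le> \<theta>" "\<theta> < 2 * pi - b" for \<theta>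
    using that b by (intro rmod_idem) simp
  have hi: "(\<theta> + b) rmod (2 * pi) = \<theta> + b - 2 * pi" if "2 * pi - b \<le> \<theta>" "\<theta> < 2 * pi" for \<theta>
    using that b by (intro rmod_unique[where n = 1]) auto
  have "(\<integral>\<^sup>+\<theta>. f ((\<theta> + a) rmod (2 * pi)) * indicator {0..<2 * pi} \<theta> \<partial>lborel) =
      (\<integral>\<^sup>+\<theta>. f (\<theta> + b) * indicator {0..<2 * pi - b} \<theta> + f (\<theta> + b - 2 * pi) * indicator {2 * pi - b..<2 * pi} \<theta> \<partial>lborel)"
    using b by (intro nn_integral_cong) (auto simp: ab lo hi indicator_def)
  also have "\<dots> = (\<integral>\<^sup>+\<theta>. f (\<theta> + b) * indicator {0..<2 * pi - b} \<theta> \<partial>lborel) +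
      (\<integral>\<^sup>+\<theta>. f (\<theta> + b - 2 * pi) * indicator {2 * pi - b..<2 * pi} \<theta> \<partial>lborel)"
    by (rule nn_integral_add) simp_all
  also have "(\<integral>\<^sup>+\<theta>. f (\<theta> + b) * indicator {0..<2 * pi - b} \<theta> \<partial>lborel) =
      (\<integral>\<^sup>+\<theta>. f \<theta> * indicator {b..<2 * pi} \<theta> \<partial>lborel)"
    by (subst nn_integral_real_affine[where c = 1 and t = "-b"])
       (auto intro!: nn_integral_cong simp: indicator_def)
  also have "(\<integral>\<^sup>+\<theta>. f (\<theta> + b - 2 * pi) * indicator {2 * pi - b..<2 * pi} \<theta> \<partial>lborel) =
      (\<integral>\<^sup>+\<theta>. f \<theta> * indicator {0..<b} \<theta> \<partial>lborel)"
    by (subst nn_integral_real_affine[where c = 1 and t = "2 * pi - b"])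
       (auto intro!: nn_integral_cong simp: indicator_def)
  also have "(\<integral>\<^sup>+\<theta>. f \<theta> * indicator {b..<2 * pi} \<theta> \<partial>lborel) + (\<integral>\<^sup>+\<theta>. f \<theta> * indicator {0..<b} \<theta> \<partial>lborel) =
      (\<integral>\<^sup>+\<theta>. f \<theta> * indicator {b..<2 * pi} \<theta> + f \<theta> * indicator {0..<b} \<theta> \<partial>lborel)"
    by (rule nn_integral_add[symmetric]) simp_all
  also have "\<dots> = (\<integral>\<^sup>+\<theta>. f \<theta> * indicator {0..<2 * pi} \<theta> \<partial>lborel)"
    using b by (intro nn_integral_cong) (auto simp: indicator_def)
  finally show ?thesis by (simp add: nn_integral_circle_unif)
qed

lemma AE_gauss2_nonzero: "AE x in gauss2. x \<noteq> 0"
proof -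
  have "AE x :: real^2 in lborel. 0 < ennreal (std_normal_density2 x) \<longrightarrow> x \<noteq> 0"
    using AE_lborel_singleton[of "0 :: real^2"] by eventually_elim simp
  then show ?thesis unfolding gauss2_def by (subst AE_density) simp_all
qed

text \<open>
  Turning \<open>x\<close> by \<open>\<theta>\<close> preserves the law and the norm and adds \<open>\<theta>\<close> to the phase, so the left-hand
  side is unchanged if the phase is shifted by any \<open>\<theta>\<close>, and hence also if the result is averaged over \<open>\<theta>\<close>.
  After exchanging the integrals, the average over \<open>\<theta>\<close> absorbs the phase of \<open>x\<close>.
\<close>

lemma nn_integral_gauss2_polar:
  assumes [measurable]: "H \<in> borel_measurable (borel \<Otimes>\<^sub>M borel)"
  shows "(\<integral>\<^sup>+x. H (norm x, phase x rmod (2 * pi)) \<partial>gauss2) =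
    (\<integral>\<^sup>+x. (\<integral>\<^sup>+\<theta>. H (norm x, \<theta>) \<partial>circle_unif) \<partial>gauss2)"
proof -
  interpret P: pair_sigma_finite gauss2 circle_unif
    by (intro pair_sigma_finite.intro gauss2.sigma_finite_measure_axioms circle_unif.sigma_finite_measure_axioms)
  have turned: "(\<integral>\<^sup>+x. H (norm x, (\<theta> + phase x) rmod (2 * pi)) \<partial>gauss2) =
      (\<integral>\<^sup>+x. H (norm x, phase x rmod (2 * pi)) \<partial>gauss2)" for \<theta>
  proof -
    have "(\<integral>\<^sup>+x. H (norm x, (\<theta> + phase x) rmod (2 * pi)) \<partial>gauss2) =
        (\<integral>\<^sup>+x. H (norm (rot \<theta> x), phase (rot \<theta> x) rmod (2 * pi)) \<partial>gauss2)"
    proof (rule nn_integral_cong_AE)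
      show "AE x in gauss2. H (norm x, (\<theta> + phase x) rmod (2 * pi)) =
          H (norm (rot \<theta> x), phase (rot \<theta> x) rmod (2 * pi))"
        using AE_gauss2_nonzero by eventually_elim (simp add: phase_rot add.commute)
    qed
    also have "\<dots> = (\<integral>\<^sup>+x. H (norm x, phase x rmod (2 * pi)) \<partial>gauss2)"
      by (rule nn_integral_gauss2_rot[where f = "\<lambda>x. H (norm x, phase x rmod (2 * pi))"]) measurable
    finally show ?thesis .
  qed
  have "(\<integral>\<^sup>+x. H (norm x, phase x rmod (2 * pi)) \<partial>gauss2) =
      (\<integral>\<^sup>+\<theta>. (\<integral>\<^sup>+x. H (norm x, (\<theta> + phase x) rmod (2 * pi)) \<partial>gauss2) \<partial>circle_unif)"
    using circle_unif.emeasure_space_1 by (simp add: turned)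
  also have "\<dots> = (\<integral>\<^sup>+x. (\<integral>\<^sup>+\<theta>. H (norm x, (\<theta> + phase x) rmod (2 * pi)) \<partial>circle_unif) \<partial>gauss2)"
    by (rule P.Fubini') measurable
  also have "\<dots> = (\<integral>\<^sup>+x. (\<integral>\<^sup>+\<theta>. H (norm x, \<theta>) \<partial>circle_unif) \<partial>gauss2)"
  proof (rule nn_integral_cong)
    fix x
    show "(\<integral>\<^sup>+\<theta>. H (norm x, (\<theta> + phase x) rmod (2 * pi)) \<partial>circle_unif) = (\<integral>\<^sup>+\<theta>. H (norm x, \<theta>) \<partial>circle_unif)"
      by (rule nn_integral_circle_unif_shift[where f = "\<lambda>\<theta>. H (norm x, \<theta>)"]) measurable
  qed
  finally show ?thesis .
qed

section \<open>The radial step\<close>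

lemma nn_integral_lborel_affine:
  fixes t :: "'a::euclidean_space"
  assumes [measurable]: "f \<in> borel_measurable borel" and "c \<noteq> 0"
  shows "(\<integral>\<^sup>+x. f x \<partial>lborel) = ennreal (\<bar>c\<bar> ^ DIM('a)) * (\<integral>\<^sup>+x. f (t + c *\<^sub>R x) \<partial>lborel)"
  using \<open>c \<noteq> 0\<close>
  by (subst lborel_affine[of c t]) (simp_all add: nn_integral_density nn_integral_distr nn_integral_cmult flip: ennreal_power)

lemma nn_integral_gauss2:
  assumes [measurable]: "f \<in> borel_measurable borel"
  shows "(\<integral>\<^sup>+x. f x \<partial>gauss2) = (\<integral>\<^sup>+x. ennreal (std_normal_density2 x) * f x \<partial>lborel)"
  by (simp add: gauss2_def nn_integral_density)

lemma std_normal_density2_nonneg: "0 \<le> std_normal_density2 x"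
  by (simp add: std_normal_density2_def)

text \<open>
  The density of \<open>(x, w)\<close> with \<open>z = c x + k w\<close>, factored into the density of \<open>z\<close> and the
  conditional density of \<open>w\<close> given \<open>z\<close>, which is that of the law with mean \<open>k z\<close> and covariance \<open>c\<^sup>2 I\<close>.
\<close>

lemma std_normal_density2_mult:
  fixes z w :: "real^2"
  assumes "c \<noteq> 0" "c\<^sup>2 + k\<^sup>2 = 1"
  shows "std_normal_density2 ((1 / c) *\<^sub>R (z - k *\<^sub>R w)) * std_normal_density2 w =
    std_normal_density2 z * std_normal_density2 ((1 / c) *\<^sub>R (w - k *\<^sub>R z))"
proof -
  have n: "(norm ((1 / c) *\<^sub>R (x - k *\<^sub>R y)))\<^sup>2 = ((norm x)\<^sup>2 - 2 * k * (x \<bullet> y) + k\<^sup>2 * (norm y)\<^sup>2) / c\<^sup>2"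
    for x y :: "real^2"
  proof -
    have "(norm (x - k *\<^sub>R y))\<^sup>2 = (norm x)\<^sup>2 - 2 * k * (x \<bullet> y) + k\<^sup>2 * (norm y)\<^sup>2"
      unfolding power2_norm_eq_inner
      by (simp add: inner_diff_left inner_diff_right inner_commute power2_eq_square)
    then show ?thesis by (simp add: power_mult_distrib power_divide)
  qed
  have k: "k\<^sup>2 = 1 - c\<^sup>2" using assms by simp
  have "(norm ((1 / c) *\<^sub>R (z - k *\<^sub>R w)))\<^sup>2 + (norm w)\<^sup>2 = (norm z)\<^sup>2 + (norm ((1 / c) *\<^sub>R (w - k *\<^sub>R z)))\<^sup>2"
    using \<open>c \<noteq> 0\<close> unfolding n k by (simp add: field_simps inner_commute)
  then have "- (norm ((1 / c) *\<^sub>R (z - k *\<^sub>R w)))\<^sup>2 / 2 + - (norm w)\<^sup>2 / 2 =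
      - (norm z)\<^sup>2 / 2 + - (norm ((1 / c) *\<^sub>R (w - k *\<^sub>R z)))\<^sup>2 / 2" by argo
  then show ?thesis
    unfolding std_normal_density2_def by (simp add: exp_add[symmetric])
qed

text \<open>
  Substituting \<open>z = c x + k w\<close> for \<open>x\<close> and then exchanging the integrals leaves, for each \<open>z\<close>, the
  integral of the conditional density of \<open>w\<close>, which is \<open>1\<close>.
\<close>

lemma nn_integral_gauss2_convolution:
  assumes [measurable]: "f \<in> borel_measurable borel" and c: "c \<noteq> 0" "c\<^sup>2 + k\<^sup>2 = 1"
  shows "(\<integral>\<^sup>+w. (\<integral>\<^sup>+x. f (c *\<^sub>R x + k *\<^sub>R w) \<partial>gauss2) \<partial>gauss2) = (\<integral>\<^sup>+z. f z \<partial>gauss2)"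
proof -
  define g where "g x = ennreal (std_normal_density2 x)" for x
  have [measurable]: "g \<in> borel_measurable borel" unfolding g_def by measurable
  define C where "C = ennreal (\<bar>1 / c\<bar> ^ DIM(real^2))"
  define T where "T a b = (1 / c) *\<^sub>R (a - k *\<^sub>R b)" for a b :: "real^2"
  have [measurable]: "(\<lambda>x. T (p x) (q x)) \<in> borel_measurable N"
    if "p \<in> borel_measurable N" "q \<in> borel_measurable N" for p q and N :: "'x measure"
    using that unfolding T_def by measurable
  have cT: "c *\<^sub>R T a b + k *\<^sub>R b = a" for a b
    using c by (simp add: T_def)
  \<comment> \<open>As \<open>T\<close> has the same form in both roles, one substitution rule serves both integrals.\<close>
  have affine: "(\<integral>\<^sup>+x. F x \<partial>lborel) = C * (\<integral>\<^sup>+z. F (T z b) \<partial>lborel)"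
    if "F \<in> borel_measurable borel" for F :: "real^2 \<Rightarrow> ennreal" and b
  proof -
    have "T z b = - (k / c) *\<^sub>R b + (1 / c) *\<^sub>R z" for z
      by (simp add: T_def scaleR_diff_right)
    then show ?thesis
      using nn_integral_lborel_affine[OF that, of "1 / c" "- (k / c) *\<^sub>R b"] c by (simp add: C_def)
  qed
  have gg: "g (T z w) * g w = g z * g (T w z)" for z w
    using std_normal_density2_mult[OF c, of z w]
    by (simp add: g_def T_def std_normal_density2_nonneg flip: ennreal_mult)
  have one: "(\<integral>\<^sup>+w. g w \<partial>lborel) = 1"
    using nn_integral_gauss2[of "\<lambda>_. 1"] gauss2.emeasure_space_1 by (simp add: g_def)
  have "(\<integral>\<^sup>+w. (\<integral>\<^sup>+x. f (c *\<^sub>R x + k *\<^sub>R w) \<partial>gauss2) \<partial>gauss2) =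
      (\<integral>\<^sup>+w. g w * (\<integral>\<^sup>+x. g x * f (c *\<^sub>R x + k *\<^sub>R w) \<partial>lborel) \<partial>lborel)"
    by (simp add: nn_integral_gauss2 g_def)
  also have "\<dots> = (\<integral>\<^sup>+w. (\<integral>\<^sup>+z. C * (g z * g (T w z) * f z) \<partial>lborel) \<partial>lborel)"
  proof (rule nn_integral_cong)
    fix w
    have "(\<integral>\<^sup>+x. g x * f (c *\<^sub>R x + k *\<^sub>R w) \<partial>lborel) = C * (\<integral>\<^sup>+z. g (T z w) * f z \<partial>lborel)"
      by (subst affine[of _ w]) (simp_all add: cT)
    then have "g w * (\<integral>\<^sup>+x. g x * f (c *\<^sub>R x + k *\<^sub>R w) \<partial>lborel) =
        (g w * C) * (\<integral>\<^sup>+z. g (T z w) * f z \<partial>lborel)"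
      by (simp only: mult.assoc)
    also have "\<dots> = (\<integral>\<^sup>+z. (g w * C) * (g (T z w) * f z) \<partial>lborel)"
      by (rule nn_integral_cmult[symmetric]) measurable
    also have "\<dots> = (\<integral>\<^sup>+z. C * (g z * g (T w z) * f z) \<partial>lborel)"
      unfolding gg[symmetric] by (simp only: mult_ac)
    finally show "g w * (\<integral>\<^sup>+x. g x * f (c *\<^sub>R x + k *\<^sub>R w) \<partial>lborel) =
        (\<integral>\<^sup>+z. C * (g z * g (T w z) * f z) \<partial>lborel)" .
  qed
  also have "\<dots> = (\<integral>\<^sup>+z. (\<integral>\<^sup>+w. C * (g z * g (T w z) * f z) \<partial>lborel) \<partial>lborel)"
    by (rule lborel_pair.Fubini') measurable
  also have "\<dots> = (\<integral>\<^sup>+z. g z * f z \<partial>lborel)"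
  proof (rule nn_integral_cong)
    fix z
    have "(\<integral>\<^sup>+w. C * (g z * g (T w z) * f z) \<partial>lborel) = (\<integral>\<^sup>+w. (g z * f z * C) * g (T w z) \<partial>lborel)"
      by (simp only: mult_ac)
    also have "\<dots> = (g z * f z * C) * (\<integral>\<^sup>+w. g (T w z) \<partial>lborel)"
      by (rule nn_integral_cmult) measurable
    also have "\<dots> = g z * f z * (\<integral>\<^sup>+w. g w \<partial>lborel)"
      by (simp only: affine[of g z] mult.assoc \<open>g \<in> borel_measurable borel\<close>)
    finally show "(\<integral>\<^sup>+w. C * (g z * g (T w z) * f z) \<partial>lborel) = g z * f z"
      by (simp add: one)
  qed
  finally show ?thesis by (simp add: nn_integral_gauss2 g_def)
qed

definition radial_step :: "real \<Rightarrow> real \<Rightarrow> real^2 \<Rightarrow> real" where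
  "radial_step k r w = sqrt ((1 - k\<^sup>2) * r\<^sup>2 + 2 * k * sqrt (1 - k\<^sup>2) * r * (w $ 1) + k\<^sup>2 * (norm w)\<^sup>2)"

lemma measurable_radial_step [measurable (raw)]:
  assumes [measurable]: "f \<in> borel_measurable N" "g \<in> borel_measurable N"
  shows "(\<lambda>\<omega>. radial_step k (f \<omega>) (g \<omega>)) \<in> borel_measurable N"
  unfolding radial_step_def by measurable

text \<open>
  The vector on the right is \<open>c (norm x, 0) + k w\<close> turned by the phase of \<open>x\<close>, and a rotation does not
  change the norm.
\<close>

lemma radial_step_eq_norm:
  assumes "k\<^sup>2 \<le> 1"
  shows "radial_step k (norm x) w = norm (sqrt (1 - k\<^sup>2) *\<^sub>R x + k *\<^sub>R rot (phase x) w)"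
proof -
  define c where "c = sqrt (1 - k\<^sup>2)"
  have c: "1 - k\<^sup>2 = c\<^sup>2" using assms by (simp add: c_def)
  define p where "p = phase x"
  have x: "x $ 1 = norm x * cos p" "x $ 2 = norm x * sin p" by (simp_all add: p_def phase_nth)
  have w: "(norm w)\<^sup>2 = (w $ 1)\<^sup>2 + (w $ 2)\<^sup>2" by (simp add: norm_vec2)
  have "(c * (norm x * cos p) + k * (cos p * w $ 1 - sin p * w $ 2))\<^sup>2 +
        (c * (norm x * sin p) + k * (sin p * w $ 1 + cos p * w $ 2))\<^sup>2 =
      ((sin p)\<^sup>2 + (cos p)\<^sup>2) * (c\<^sup>2 * (norm x)\<^sup>2 + 2 * k * c * norm x * (w $ 1) + k\<^sup>2 * ((w $ 1)\<^sup>2 + (w $ 2)\<^sup>2))"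
    by algebra
  then show ?thesis
    unfolding radial_step_def c_def[symmetric] unfolding c w p_def[symmetric]
    by (subst norm_vec2) (simp add: x)
qed

lemma nn_integral_radial_step:
  assumes [measurable]: "G \<in> borel_measurable borel" and k: "k\<^sup>2 < 1"
  shows "(\<integral>\<^sup>+x. (\<integral>\<^sup>+w. G (radial_step k (norm x) w) \<partial>gauss2) \<partial>gauss2) = (\<integral>\<^sup>+x. G (norm x) \<partial>gauss2)"
proof -
  interpret P: pair_sigma_finite gauss2 gauss2 ..
  define c where "c = sqrt (1 - k\<^sup>2)"
  have c: "c \<noteq> 0" "c\<^sup>2 + k\<^sup>2 = 1" using k by (auto simp: c_def)
  have "(\<integral>\<^sup>+x. (\<integral>\<^sup>+w. G (radial_step k (norm x) w) \<partial>gauss2) \<partial>gauss2) =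
      (\<integral>\<^sup>+x. (\<integral>\<^sup>+w. G (norm (c *\<^sub>R x + k *\<^sub>R rot (phase x) w)) \<partial>gauss2) \<partial>gauss2)"
    using k by (simp add: radial_step_eq_norm c_def)
  also have "\<dots> = (\<integral>\<^sup>+x. (\<integral>\<^sup>+w. G (norm (c *\<^sub>R x + k *\<^sub>R w)) \<partial>gauss2) \<partial>gauss2)"
  proof (rule nn_integral_cong)
    fix x
    show "(\<integral>\<^sup>+w. G (norm (c *\<^sub>R x + k *\<^sub>R rot (phase x) w)) \<partial>gauss2) = (\<integral>\<^sup>+w. G (norm (c *\<^sub>R x + k *\<^sub>R w)) \<partial>gauss2)"
      by (rule nn_integral_gauss2_rot[where f = "\<lambda>w. G (norm (c *\<^sub>R x + k *\<^sub>R w))"]) measurable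
  qed
  also have "\<dots> = (\<integral>\<^sup>+w. (\<integral>\<^sup>+x. G (norm (c *\<^sub>R x + k *\<^sub>R w)) \<partial>gauss2) \<partial>gauss2)"
    by (rule P.Fubini'[symmetric]) measurable
  also have "\<dots> = (\<integral>\<^sup>+x. G (norm x) \<partial>gauss2)"
    by (rule nn_integral_gauss2_convolution[where f = "\<lambda>z. G (norm z)", OF _ c]) measurable
  finally show ?thesis .
qed

text \<open>
  By the polar decomposition the phase of \<open>x\<close> may be replaced by an independent uniform
  angle.  That angle absorbs the increment \<open>h t\<close>, the remaining integrand is radial, and the radial step
  preserves the law of the norm.  The polar decomposition, read backwards, restores the phase of \<open>x\<close>.
\<close>

lemma nn_integral_gauss2_step:
  fixes T :: "real measure"
  assumes "prob_space T" and sets_T [measurable_cong]: "sets T = sets borel"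
    and [measurable]: "H \<in> borel_measurable (borel \<Otimes>\<^sub>M borel)" and k: "k\<^sup>2 < 1"
  shows "(\<integral>\<^sup>+x. (\<integral>\<^sup>+v. H (radial_step k (norm x) (fst v), (phase x + h * snd v) rmod (2 * pi)) \<partial>(gauss2 \<Otimes>\<^sub>M T)) \<partial>gauss2) =
    (\<integral>\<^sup>+x. H (norm x, phase x rmod (2 * pi)) \<partial>gauss2)"
proof -
  interpret T: prob_space T by fact
  interpret WT: pair_prob_space gauss2 T ..
  interpret P: pair_sigma_finite circle_unif "gauss2 \<Otimes>\<^sub>M T"
    by (intro pair_sigma_finite.intro circle_unif.sigma_finite_measure_axioms WT.sigma_finite_measure_axioms)
  define K where "K p = (\<integral>\<^sup>+v. H (radial_step k (fst p) (fst v), (snd p + h * snd v) rmod (2 * pi)) \<partial>(gauss2 \<Otimes>\<^sub>M T))" for p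
  have [measurable]: "K \<in> borel_measurable (borel \<Otimes>\<^sub>M borel)" unfolding K_def by measurable
  define G where "G r = (\<integral>\<^sup>+\<theta>. H (r, \<theta>) \<partial>circle_unif)" for r
  have [measurable]: "G \<in> borel_measurable borel" unfolding G_def by measurable
  have avg: "(\<integral>\<^sup>+\<theta>. K (r, \<theta>) \<partial>circle_unif) = (\<integral>\<^sup>+w. G (radial_step k r w) \<partial>gauss2)" for r
  proof -
    have "(\<integral>\<^sup>+\<theta>. K (r, \<theta>) \<partial>circle_unif) =
        (\<integral>\<^sup>+v. (\<integral>\<^sup>+\<theta>. H (radial_step k r (fst v), (\<theta> + h * snd v) rmod (2 * pi)) \<partial>circle_unif) \<partial>(gauss2 \<Otimes>\<^sub>M T))"
      unfolding K_def fst_conv snd_conv by (rule P.Fubini'[symmetric]) measurable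
    also have "\<dots> = (\<integral>\<^sup>+v. G (radial_step k r (fst v)) \<partial>(gauss2 \<Otimes>\<^sub>M T))"
    proof (rule nn_integral_cong)
      fix v :: "(real^2) \<times> real"
      show "(\<integral>\<^sup>+\<theta>. H (radial_step k r (fst v), (\<theta> + h * snd v) rmod (2 * pi)) \<partial>circle_unif) = G (radial_step k r (fst v))"
        unfolding G_def
        by (rule nn_integral_circle_unif_shift[where f = "\<lambda>\<theta>. H (radial_step k r (fst v), \<theta>)"]) measurable
    qed
    also have "\<dots> = (\<integral>\<^sup>+w. (\<integral>\<^sup>+t. G (radial_step k r w) \<partial>T) \<partial>gauss2)"
      by (subst T.nn_integral_fst[symmetric]) simp_all
    finally show ?thesis by (simp add: T.emeasure_space_1)
  qed
  have "(\<integral>\<^sup>+x. (\<integral>\<^sup>+v. H (radial_step k (norm x) (fst v), (phase x + h * snd v) rmod (2 * pi)) \<partial>(gauss2 \<Otimes>\<^sub>M T)) \<partial>gauss2) =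
      (\<integral>\<^sup>+x. K (norm x, phase x rmod (2 * pi)) \<partial>gauss2)"
  proof (intro nn_integral_cong)
    have *: "(\<phi> rmod (2 * pi) + a) rmod (2 * pi) = (\<phi> + a) rmod (2 * pi)" for \<phi> a
      using rmod_add[of "\<phi> rmod (2 * pi)" "2 * pi" a] rmod_add[of \<phi> "2 * pi" a] by simp
    show "(\<integral>\<^sup>+v. H (radial_step k (norm x) (fst v), (phase x + h * snd v) rmod (2 * pi)) \<partial>(gauss2 \<Otimes>\<^sub>M T)) =
        K (norm x, phase x rmod (2 * pi))" for x
      by (simp add: K_def *)
  qed
  also have "\<dots> = (\<integral>\<^sup>+x. (\<integral>\<^sup>+\<theta>. K (norm x, \<theta>) \<partial>circle_unif) \<partial>gauss2)"
    by (rule nn_integral_gauss2_polar) measurable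
  also have "\<dots> = (\<integral>\<^sup>+x. G (norm x) \<partial>gauss2)"
    unfolding avg using k by (rule nn_integral_radial_step[rotated]) measurable
  also have "\<dots> = (\<integral>\<^sup>+x. H (norm x, phase x rmod (2 * pi)) \<partial>gauss2)"
    unfolding G_def by (rule nn_integral_gauss2_polar[symmetric]) measurable
  finally show ?thesis .
qed

section \<open>Invariance of the Gaussian law\<close>

theorem mainTheorem2:
  fixes M :: "'a measure"
    and X W X' :: "'a \<Rightarrow> real^2"
    and \<Omega> R \<phi> R' \<phi>' :: "'a \<Rightarrow> real"
    and h k :: real
  assumes "prob_space M"
    and "h > 0" and "0 < k" and "k < 1"
    and "distributed M lborel X std_normal_density2"
    and "distributed M lborel W std_normal_density2"
    and "distributed M lborel \<Omega> std_normal_density"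
    and "prob_space.indep_vars3 M borel X borel W borel \<Omega>"
    and "R = (\<lambda>\<omega>. norm (X \<omega>))"
    and "\<phi> = (\<lambda>\<omega>. phase (X \<omega>))"
    and "R' = (\<lambda>\<omega>. sqrt ((1 - k\<^sup>2) * (R \<omega>)\<^sup>2
                 + 2 * k * sqrt (1 - k\<^sup>2) * R \<omega> * (W \<omega> $ 1)
                 + k\<^sup>2 * (norm (W \<omega>))\<^sup>2))"
    and "\<phi>' = (\<lambda>\<omega>. \<phi> \<omega> + h * \<Omega> \<omega>)"
    and "X' = (\<lambda>\<omega>. vector [R' \<omega> * cos (\<phi>' \<omega>), R' \<omega> * sin (\<phi>' \<omega>)])"
  shows "distributed M lborel R' rayleigh_density
    \<and> distr M borel (\<lambda>\<omega>. \<phi>' \<omega> rmod (2 * pi)) = uniform_measure lborel {0..<2 * pi}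
    \<and> distributed M lborel X' std_normal_density2
    \<and> distr M borel X' = distr M borel X"
proof -
  interpret M: prob_space M by fact
  have [measurable]: "X \<in> borel_measurable M" "W \<in> borel_measurable M" "\<Omega> \<in> borel_measurable M"
    using assms(5-7) by (simp_all add: distributed_def)
  have lawX: "distr M borel X = gauss2" and lawW: "distr M borel W = gauss2"
    using assms(5,6) by (simp_all add: distributed_def gauss2_def cong: distr_cong)
  define T where "T = distr M borel \<Omega>"
  interpret T: prob_space T unfolding T_def by (rule M.prob_space_distr) measurable
  have [measurable_cong]: "sets T = sets borel" by (simp add: T_def)
  interpret WT: pair_prob_space gauss2 T ..
  have R': "R' = (\<lambda>\<omega>. radial_step k (norm (X \<omega>)) (W \<omega>))"
    using assms(9,11) by (simp add: radial_step_def)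
  have \<phi>': "\<phi>' = (\<lambda>\<omega>. phase (X \<omega>) + h * \<Omega> \<omega>)"
    using assms(10,12) by simp
  have [measurable]: "R' \<in> borel_measurable M" "\<phi>' \<in> borel_measurable M"
    unfolding R' \<phi>' by measurable
  have [measurable]: "X' \<in> borel_measurable M"
    unfolding assms(13) by measurable
  have k: "k\<^sup>2 < 1" using assms(3,4) by (simp add: power_less_one_iff abs_square_less_1)
  have joint: "(\<integral>\<^sup>+\<omega>. H (R' \<omega>, \<phi>' \<omega> rmod (2 * pi)) \<partial>M) = (\<integral>\<^sup>+x. H (norm x, phase x rmod (2 * pi)) \<partial>gauss2)"
    if [measurable]: "H \<in> borel_measurable (borel \<Otimes>\<^sub>M borel)" for H :: "real \<times> real \<Rightarrow> ennreal"
  proof -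
    define J where "J p = H (radial_step k (norm (fst p)) (fst (snd p)), (phase (fst p) + h * snd (snd p)) rmod (2 * pi))"
      for p :: "(real^2) \<times> (real^2) \<times> real"
    have [measurable]: "J \<in> borel_measurable (borel \<Otimes>\<^sub>M (borel \<Otimes>\<^sub>M borel))"
      unfolding J_def by measurable
    have "(\<integral>\<^sup>+\<omega>. H (R' \<omega>, \<phi>' \<omega> rmod (2 * pi)) \<partial>M) = (\<integral>\<^sup>+\<omega>. J (X \<omega>, W \<omega>, \<Omega> \<omega>) \<partial>M)"
      by (simp add: J_def R' \<phi>')
    also have "\<dots> = (\<integral>\<^sup>+p. J p \<partial>distr M (borel \<Otimes>\<^sub>M (borel \<Otimes>\<^sub>M borel)) (\<lambda>\<omega>. (X \<omega>, W \<omega>, \<Omega> \<omega>)))"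
      by (simp add: nn_integral_distr)
    also have "distr M (borel \<Otimes>\<^sub>M (borel \<Otimes>\<^sub>M borel)) (\<lambda>\<omega>. (X \<omega>, W \<omega>, \<Omega> \<omega>)) = gauss2 \<Otimes>\<^sub>M (gauss2 \<Otimes>\<^sub>M T)"
      using M.distr_indep_vars3[OF assms(8)] by (simp add: lawX lawW T_def)
    also have "(\<integral>\<^sup>+p. J p \<partial>(gauss2 \<Otimes>\<^sub>M (gauss2 \<Otimes>\<^sub>M T))) = (\<integral>\<^sup>+x. (\<integral>\<^sup>+v. J (x, v) \<partial>(gauss2 \<Otimes>\<^sub>M T)) \<partial>gauss2)"
      by (rule WT.nn_integral_fst[symmetric]) measurable
    also have "\<dots> = (\<integral>\<^sup>+x. H (norm x, phase x rmod (2 * pi)) \<partial>gauss2)"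
      unfolding J_def fst_conv snd_conv
      by (rule nn_integral_gauss2_step[OF T.prob_space_axioms _ that k]) (simp add: T_def)
    finally show ?thesis .
  qed
  have joint_distr: "distr M N (\<lambda>\<omega>. F (R' \<omega>, \<phi>' \<omega> rmod (2 * pi))) = distr gauss2 N (\<lambda>x. F (norm x, phase x rmod (2 * pi)))"
    if [measurable]: "F \<in> borel \<Otimes>\<^sub>M borel \<rightarrow>\<^sub>M N" for F :: "real \<times> real \<Rightarrow> 'z" and N
  proof (rule measure_eqI)
    fix A assume "A \<in> sets (distr M N (\<lambda>\<omega>. F (R' \<omega>, \<phi>' \<omega> rmod (2 * pi))))"
    then have [measurable]: "A \<in> sets N" by simp
    from joint[of "\<lambda>p. indicator A (F p)"]
    show "emeasure (distr M N (\<lambda>\<omega>. F (R' \<omega>, \<phi>' \<omega> rmod (2 * pi)))) A =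
        emeasure (distr gauss2 N (\<lambda>x. F (norm x, phase x rmod (2 * pi)))) A"
      by (simp add: nn_integral_distr flip: nn_integral_indicator)
  qed simp
  have "distr M borel R' = density lborel (\<lambda>\<rho>. ennreal (rayleigh_density \<rho>))"
    using joint_distr[of fst borel] by (simp add: distr_gauss2_norm)
  moreover have "distr M borel (\<lambda>\<omega>. \<phi>' \<omega> rmod (2 * pi)) = circle_unif"
  proof (rule measure_eqI)
    fix A assume "A \<in> sets (distr M borel (\<lambda>\<omega>. \<phi>' \<omega> rmod (2 * pi)))"
    then have [measurable]: "A \<in> sets borel" by simp
    have "emeasure (distr M borel (\<lambda>\<omega>. \<phi>' \<omega> rmod (2 * pi))) A = (\<integral>\<^sup>+x. indicator A (phase x rmod (2 * pi)) \<partial>gauss2)"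
      using joint[of "\<lambda>p. indicator A (snd p)"] by (simp add: nn_integral_distr flip: nn_integral_indicator)
    also have "\<dots> = (\<integral>\<^sup>+x. (\<integral>\<^sup>+\<theta>. indicator A \<theta> \<partial>circle_unif) \<partial>(gauss2 :: (real^2) measure))"
      using nn_integral_gauss2_polar[of "\<lambda>p. indicator A (snd p)"] by simp
    also have "\<dots> = emeasure circle_unif A"
      using gauss2.emeasure_space_1 by simp
    finally show "emeasure (distr M borel (\<lambda>\<omega>. \<phi>' \<omega> rmod (2 * pi))) A = emeasure circle_unif A" .
  qed simp
  moreover have "distr M borel X' = gauss2"
  proof -
    define F where "F p = (vector [fst p * cos (snd p), fst p * sin (snd p)] :: real^2)" for p
    have [measurable]: "F \<in> borel \<Otimes>\<^sub>M borel \<rightarrow>\<^sub>M borel" unfolding F_def by measurable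
    have "X' = (\<lambda>\<omega>. F (R' \<omega>, \<phi>' \<omega> rmod (2 * pi)))"
      by (simp add: F_def assms(13))
    then have "distr M borel X' = distr gauss2 borel (\<lambda>x. F (norm x, phase x rmod (2 * pi)))"
      by (simp add: joint_distr)
    also have "(\<lambda>x. F (norm x, phase x rmod (2 * pi))) = (\<lambda>x. x)"
      by (simp add: F_def fun_eq_iff flip: phase_polar)
    finally show ?thesis by (simp add: distr_id2)
  qed
  ultimately show ?thesis
    by (simp add: distributed_def lawX circle_unif_def gauss2_def cong: distr_cong)
qed

end
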